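(* Let $n\ge 6$ and let $s\in(0,1)$ be such that $k_0 := 1+\sum_{k=1}^{n-1}\frac{1}{1+k^s}$ is an integer. Then the sequence $\{A_{n,k}(s)\}_{k}$ has a peak at $k_0$, i.e. $k_0$ is its unique mode (unique index at which the maximum over $k$ is attained). Moreover, the set of integers $k_0$ arising in this way from some $s\in(0,1)$ is exactly the set of integers strictly between $H_n$ and $\frac{n+1}{2}$, where $H_n=\sum_{j=1}^n 1/j$.
   Context: For $s\in\mathbb{R}$ define polynomials $P_n^{h_s}(x)$ recursively by $P_0^{h_s}(x):=1$ and, for $n\ge 1$, $P_n^{h_s}(x) := \frac{x}{n^s}\sum_{k=0}^{n-1} P_k^{h_s}(x)$, and write $P_n^{h_s}(x)=\sum_{k=0}^n A_{n,k}(s)\,x^k$. *)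

theory Defs
  imports "HOL-Analysis.Harmonic_Numbers" "HOL-Computational_Algebra.Polynomial"
begin

fun P :: "real \<Rightarrow> nat \<Rightarrow> real poly" where
  "P s n = (if n = 0 then 1
            else smult (1 / real n powr s) (monom 1 1 * (\<Sum>k\<in>{0..<n}. P s k)))"

declare P.simps [simp del]

definition A :: "nat \<Rightarrow> nat \<Rightarrow> real \<Rightarrow> real" where
  "A n k s = coeff (P s n) k"

definition k0 :: "nat \<Rightarrow> real \<Rightarrow> real" where
  "k0 n s = 1 + (\<Sum>k=1..n-1. 1 / (1 + real k powr s))"

definition modes :: "nat \<Rightarrow> (nat \<Rightarrow> real) \<Rightarrow> nat set" where
  "modes n a = {k. is_arg_max a (\<lambda>j. j \<le> n) k}"

definition has_peak_at :: "nat \<Rightarrow> (nat \<Rightarrow> real) \<Rightarrow> nat \<Rightarrow> bool" where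
  "has_peak_at n a k \<longleftrightarrow> modes n a = {k}"

end

theory Submission
  imports Defs
begin

text \<open>
  The recursion telescopes to \<open>P s n = x / (n!)\<^sup>s * F\<close> with \<open>F = (\<Prod>k=1..n-1. k\<^sup>s + x)\<close>, so the claim
  is Darroch's theorem on the mode of a Poisson-binomial distribution with integer mean.
  For \<open>F = (\<Prod>i\<in>I. a i + x)\<close>, \<open>F\<^sub>i = F / (a i + x)\<close> and \<open>\<mu> = (\<Sum>i\<in>I. 1 / (1 + a i))\<close> one has
  \<open>(\<Sum>i\<in>I. a i / (1 + a i) * (x - 1) * F\<^sub>i) = x * F' - \<mu> * F\<close>. If \<open>\<mu> = m\<close> is an integer, the \<open>m\<close>-th
  coefficient of the right-hand side vanishes, so \<open>coeff F\<^sub>i m \<le> coeff F\<^sub>i (m-1)\<close> for some \<open>i\<close> and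
  \<open>coeff F\<^sub>h (m-1) \<le> coeff F\<^sub>h m\<close> for some \<open>h\<close>. By strict log-concavity of \<open>F\<^sub>i\<close> and \<open>F\<^sub>h\<close>,
  the former gives \<open>coeff F (m+1) < coeff F m\<close> and the latter \<open>coeff F (m-1) < coeff F m\<close>,
  which strict log-concavity of \<open>F\<close> turns into a unique maximum at \<open>m\<close>.
  The range of \<open>k0\<close> follows from its continuity and strict monotonicity in \<open>s\<close>.
\<close>

section \<open>Strictly log-concave polynomials\<close>

text \<open>
  For positive coefficients \<open>c\<close> this amounts to \<open>c k * c (k + 2) < (c (k + 1))\<^sup>2\<close>; the form with two
  indices makes products with linear factors a matter of adding up inequalities.
\<close>

definition strict_log_concave :: "'a::linordered_idom poly \<Rightarrow> bool" where
  "strict_log_concave p \<longleftrightarrow>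
     (\<forall>k\<le>degree p. 0 < coeff p k) \<and>
     (\<forall>i j. i < j \<longrightarrow> j \<le> degree p \<longrightarrow> coeff p i * coeff p (Suc j) < coeff p (Suc i) * coeff p j)"

lemma strict_log_concave_coeff_pos: "strict_log_concave p \<Longrightarrow> k \<le> degree p \<Longrightarrow> 0 < coeff p k"
  by (simp add: strict_log_concave_def)

lemma strict_log_concave_coeff_nonneg: "strict_log_concave p \<Longrightarrow> 0 \<le> coeff p k"
  by (cases "k \<le> degree p") (simp_all add: strict_log_concave_coeff_pos less_imp_le coeff_eq_0)

lemma strict_log_concave_mult_less:
  "strict_log_concave p \<Longrightarrow> i < j \<Longrightarrow> j \<le> degree p \<Longrightarrow>
     coeff p i * coeff p (Suc j) < coeff p (Suc i) * coeff p j"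
  by (simp add: strict_log_concave_def)

lemma strict_log_concave_mult_le:
  assumes "strict_log_concave p" "i \<le> j"
  shows "coeff p i * coeff p (Suc j) \<le> coeff p (Suc i) * coeff p j"
proof -
  consider "i = j" | "i < j" "j \<le> degree p" | "degree p < j" using assms(2) by linarith
  then show ?thesis
    using strict_log_concave_mult_less[OF assms(1)] by cases (auto simp: coeff_eq_0 less_imp_le)
qed

lemma strict_log_concave_outer_mult_le:
  assumes "strict_log_concave p" "i < j"
  shows "coeff p i * coeff p (Suc (Suc j)) \<le> coeff p (Suc (Suc i)) * coeff p j"
proof -
  have "coeff p i * coeff p (Suc (Suc j)) \<le> coeff p (Suc i) * coeff p (Suc j)"
    using assms by (intro strict_log_concave_mult_le) auto
  also have "\<dots> \<le> coeff p (Suc (Suc i)) * coeff p j"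
    using assms by (intro strict_log_concave_mult_le) auto
  finally show ?thesis .
qed

lemma coeff_linear_mult:
  fixes a :: "'a::comm_semiring_1"
  shows "coeff ([:a, 1:] * p) k = a * coeff p k + coeff (pCons 0 p) k"
  by simp

lemma degree_linear_mult:
  fixes a :: "'a::idom"
  assumes "p \<noteq> 0"
  shows "degree ([:a, 1:] * p) = Suc (degree p)"
  using assms by (subst degree_mult_eq) auto

lemma strict_log_concave_linear_mult_less:
  assumes p: "strict_log_concave p" and a: "0 < a" and "i < j" "j \<le> Suc (degree p)"
  shows "coeff ([:a, 1:] * p) i * coeff ([:a, 1:] * p) (Suc j) <
         coeff ([:a, 1:] * p) (Suc i) * coeff ([:a, 1:] * p) j"
proof -
  obtain l where l: "j = Suc l" "i \<le> l" "l \<le> degree p" using assms(3,4) by (cases j) auto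
  define c b where "c = coeff p" and "b = coeff (pCons 0 p) i"
  have "0 \<le> c (Suc i) * c (Suc l) - c i * c (Suc (Suc l))"
    using strict_log_concave_mult_le[OF p, of i "Suc l"] l(2) by (simp add: c_def)
  then have quadratic_part: "0 \<le> a\<^sup>2 * (c (Suc i) * c (Suc l) - c i * c (Suc (Suc l)))"
    by simp
  have "b * c (Suc (Suc l)) \<le> c (Suc i) * c l \<and> b * c (Suc l) < c i * c l"
  proof (cases i)
    case 0
    then show ?thesis
      using strict_log_concave_coeff_nonneg[OF p] strict_log_concave_coeff_pos[OF p] l(3)
      by (simp add: b_def c_def)
  next
    case (Suc h)
    then show ?thesis
      using strict_log_concave_outer_mult_le[OF p, of h l]
        strict_log_concave_mult_less[OF p, of h l] l
      by (simp add: b_def c_def)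
  qed
  then have linear_part: "0 \<le> a * (c (Suc i) * c l - b * c (Suc (Suc l)))"
    and constant_part: "0 < c i * c l - b * c (Suc l)"
    using a by simp_all
  have "(a * c (Suc i) + c i) * (a * c (Suc l) + c l) -
          (a * c i + b) * (a * c (Suc (Suc l)) + c (Suc l)) =
        a\<^sup>2 * (c (Suc i) * c (Suc l) - c i * c (Suc (Suc l))) +
        a * (c (Suc i) * c l - b * c (Suc (Suc l))) + (c i * c l - b * c (Suc l))"
    by (simp add: algebra_simps power2_eq_square)
  then show ?thesis
    using quadratic_part linear_part constant_part
    unfolding coeff_linear_mult l(1) coeff_pCons_Suc b_def[symmetric] c_def[symmetric] by linarith
qed

lemma strict_log_concave_linear_mult:
  assumes p: "strict_log_concave p" and a: "0 < a"
  shows "strict_log_concave ([:a, 1:] * p)"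
proof -
  have "p \<noteq> 0" using strict_log_concave_coeff_pos[OF p, of 0] by auto
  note degree = degree_linear_mult[OF this, of a]
  have "0 < coeff ([:a, 1:] * p) k" if "k \<le> Suc (degree p)" for k
  proof (cases k)
    case 0
    then show ?thesis using a strict_log_concave_coeff_pos[OF p] by simp
  next
    case (Suc l)
    then have "0 \<le> a * coeff p (Suc l)" "0 < coeff p l"
      using a that strict_log_concave_coeff_pos[OF p] strict_log_concave_coeff_nonneg[OF p]
      by simp_all
    then show ?thesis unfolding coeff_linear_mult Suc coeff_pCons_Suc by (rule add_nonneg_pos)
  qed
  then show ?thesis
    unfolding strict_log_concave_def degree
    using strict_log_concave_linear_mult_less[OF assms] by blast
qed

lemma strict_log_concave_decreasing:
  assumes p: "strict_log_concave p" and "coeff p (Suc i) \<le> coeff p i" "i < j" "j \<le> degree p"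
  shows "coeff p (Suc j) < coeff p j"
proof -
  have "coeff p i * coeff p (Suc j) < coeff p (Suc i) * coeff p j"
    using p assms(3,4) by (rule strict_log_concave_mult_less)
  also have "\<dots> \<le> coeff p i * coeff p j"
    using assms(2) strict_log_concave_coeff_nonneg[OF p] by (rule mult_right_mono)
  finally show ?thesis
    using strict_log_concave_coeff_pos[OF p, of i] assms(3,4) by simp
qed

lemma strict_log_concave_increasing:
  assumes "strict_log_concave p" "coeff p j \<le> coeff p (Suc j)" "i < j" "j \<le> degree p"
  shows "coeff p i < coeff p (Suc i)"
  using strict_log_concave_decreasing[OF assms(1) _ assms(3,4)] assms(2)
  by (meson leD le_less_linear)

lemma strict_log_concave_peak:
  assumes p: "strict_log_concave p"
    and left: "coeff p m < coeff p (Suc m)"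
    and right: "coeff p (Suc (Suc m)) < coeff p (Suc m)"
    and "j \<noteq> Suc m"
  shows "coeff p j < coeff p (Suc m)"
proof -
  have m: "Suc m \<le> degree p"
    using left strict_log_concave_coeff_nonneg[OF p, of m] by (intro le_degree) auto
  consider "Suc (Suc m) \<le> j" | "j \<le> m" using assms(4) by linarith
  then show ?thesis
  proof cases
    case 1
    then show ?thesis
    proof (induction rule: dec_induct)
      case base
      show ?case by (rule right)
    next
      case (step k)
      have "coeff p (Suc k) \<le> coeff p k"
      proof (cases "k \<le> degree p")
        case True
        then show ?thesis
          using strict_log_concave_decreasing[OF p, of "Suc m" k] right step.hyps by simp
      qed (simp add: coeff_eq_0)
      with step.IH show ?case by simp
    qed
  next
    case 2
    then show ?thesis
    proof (induction rule: inc_induct)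
      case base
      show ?case by (rule left)
    next
      case (step k)
      have "coeff p k < coeff p (Suc k)"
        using strict_log_concave_increasing[OF p, of m k] left step.hyps m by simp
      with step.IH show ?case by simp
    qed
  qed
qed

lemma linear_mult_coeff_decreasing:
  assumes p: "strict_log_concave p" and a: "0 < a"
    and "l < degree p" "coeff p (Suc l) \<le> coeff p l"
  shows "coeff ([:a, 1:] * p) (Suc (Suc l)) < coeff ([:a, 1:] * p) (Suc l)"
proof -
  have "coeff p (Suc (Suc l)) < coeff p (Suc l)"
    using strict_log_concave_decreasing[OF p assms(4)] assms(3) by simp
  then have "a * coeff p (Suc (Suc l)) < a * coeff p (Suc l)" using a by simp
  then show ?thesis
    using assms(4) unfolding coeff_linear_mult coeff_pCons_Suc by (rule add_less_le_mono)
qed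

lemma linear_mult_coeff_increasing:
  assumes p: "strict_log_concave p" and a: "0 < a"
    and "l \<le> degree p" "coeff p l \<le> coeff p (Suc l)"
  shows "coeff ([:a, 1:] * p) l < coeff ([:a, 1:] * p) (Suc l)"
proof -
  have "coeff (pCons 0 p) l < coeff p l"
  proof (cases l)
    case 0
    then show ?thesis using strict_log_concave_coeff_pos[OF p] by simp
  next
    case (Suc k)
    then show ?thesis using strict_log_concave_increasing[OF p assms(4) _ assms(3)] by simp
  qed
  moreover have "a * coeff p l \<le> a * coeff p (Suc l)" using a assms(4) by simp
  ultimately show ?thesis
    unfolding coeff_linear_mult coeff_pCons_Suc by (intro add_le_less_mono)
qed

section \<open>Darroch's theorem for integer means\<close>

definition linear_prod :: "('i \<Rightarrow> 'a::comm_semiring_1) \<Rightarrow> 'i set \<Rightarrow> 'a poly" where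
  "linear_prod a I = (\<Prod>i\<in>I. [:a i, 1:])"

lemma linear_prod_remove:
  "finite I \<Longrightarrow> i \<in> I \<Longrightarrow> linear_prod a I = [:a i, 1:] * linear_prod a (I - {i})"
  unfolding linear_prod_def by (rule prod.remove)

lemma degree_linear_prod:
  fixes a :: "'i \<Rightarrow> 'a::idom"
  shows "degree (linear_prod a I) = card I"
  by (simp add: linear_prod_def degree_prod_sum_eq)

lemma pderiv_linear_prod:
  fixes a :: "'i \<Rightarrow> 'a::idom"
  shows "pderiv (linear_prod a I) = (\<Sum>i\<in>I. linear_prod a (I - {i}))"
  by (simp add: linear_prod_def pderiv_prod pderiv_pCons)

lemma strict_log_concave_linear_prod:
  fixes a :: "'i \<Rightarrow> 'a::linordered_idom"
  assumes "finite I" "\<And>i. i \<in> I \<Longrightarrow> 0 < a i"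
  shows "strict_log_concave (linear_prod a I)"
  using assms
proof (induction I rule: finite_induct)
  case empty
  then show ?case by (simp add: linear_prod_def strict_log_concave_def)
next
  case (insert i I)
  then show ?case
    using strict_log_concave_linear_mult[of "linear_prod a I" "a i"] by (simp add: linear_prod_def)
qed

lemma linear_prod_mean_identity:
  fixes a :: "'i \<Rightarrow> 'a::field"
  assumes "finite I" "\<And>i. i \<in> I \<Longrightarrow> 1 + a i \<noteq> 0"
  shows "(\<Sum>i\<in>I. smult (a i / (1 + a i)) ([:-1, 1:] * linear_prod a (I - {i}))) =
         pCons 0 (pderiv (linear_prod a I)) - smult (\<Sum>i\<in>I. 1 / (1 + a i)) (linear_prod a I)"
proof -
  have "smult (a i / (1 + a i)) ([:-1, 1:] * linear_prod a (I - {i})) =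
      [:0, 1:] * linear_prod a (I - {i}) - smult (1 / (1 + a i)) (linear_prod a I)"
    if i: "i \<in> I" for i
  proof -
    have "smult (a i / (1 + a i)) [:-1, 1:] = [:0, 1:] - smult (1 / (1 + a i)) [:a i, 1:]"
      using assms(2)[OF i] by (simp add: field_simps)
    then show ?thesis
      unfolding linear_prod_remove[OF assms(1) i] by (metis left_diff_distrib mult_smult_left)
  qed
  then have "(\<Sum>i\<in>I. smult (a i / (1 + a i)) ([:-1, 1:] * linear_prod a (I - {i}))) =
      (\<Sum>i\<in>I. [:0, 1:] * linear_prod a (I - {i}) - smult (1 / (1 + a i)) (linear_prod a I))"
    by (rule sum.cong[OF refl])
  also have "\<dots> = [:0, 1:] * (\<Sum>i\<in>I. linear_prod a (I - {i})) -
      smult (\<Sum>i\<in>I. 1 / (1 + a i)) (linear_prod a I)"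
    by (simp only: sum_subtractf sum_distrib_left smult_sum)
  finally show ?thesis by (simp add: pderiv_linear_prod)
qed

lemma sum_weighted_coeff_diff_eq_0:
  fixes a :: "'i \<Rightarrow> 'a::field"
  assumes "finite I" "\<And>i. i \<in> I \<Longrightarrow> 1 + a i \<noteq> 0"
    and mean: "(\<Sum>i\<in>I. 1 / (1 + a i)) = of_nat (Suc l)"
  shows "(\<Sum>i\<in>I. a i / (1 + a i) *
           (coeff (linear_prod a (I - {i})) l - coeff (linear_prod a (I - {i})) (Suc l))) = 0"
    (is "?lhs = 0")
proof -
  have "?lhs = coeff (\<Sum>i\<in>I. smult (a i / (1 + a i)) ([:-1, 1:] * linear_prod a (I - {i}))) (Suc l)"
    by (simp add: coeff_sum)
  also have "\<dots> = coeff (pCons 0 (pderiv (linear_prod a I)) -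
      smult (of_nat (Suc l)) (linear_prod a I)) (Suc l)"
    by (simp only: linear_prod_mean_identity[OF assms(1,2)] mean)
  also have "\<dots> = 0" by (simp only: coeff_diff coeff_pCons_Suc coeff_pderiv coeff_smult) simp
  finally show ?thesis .
qed

lemma ex_nonneg_if_weighted_sum_eq_0:
  fixes x :: "'i \<Rightarrow> 'a::linordered_idom"
  assumes "finite I" "I \<noteq> {}" "\<And>i. i \<in> I \<Longrightarrow> 0 < w i" "(\<Sum>i\<in>I. w i * x i) = 0"
  shows "\<exists>i\<in>I. 0 \<le> x i"
proof (rule ccontr)
  assume "\<not> ?thesis"
  then have "(\<Sum>i\<in>I. w i * x i) < (\<Sum>i\<in>I. 0)"
    using assms(1-3) by (intro sum_strict_mono mult_pos_neg) auto
  then show False using assms(4) by simp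
qed

lemma sum_inverse_one_plus_pos:
  fixes a :: "'i \<Rightarrow> 'a::linordered_field"
  assumes "finite I" "I \<noteq> {}" "\<And>i. i \<in> I \<Longrightarrow> 0 < a i"
  shows "0 < (\<Sum>i\<in>I. 1 / (1 + a i))"
  using assms by (intro sum_pos) (auto intro: add_pos_pos)

lemma sum_inverse_one_plus_less_card:
  fixes a :: "'i \<Rightarrow> 'a::linordered_field"
  assumes "finite I" "I \<noteq> {}" "\<And>i. i \<in> I \<Longrightarrow> 0 < a i"
  shows "(\<Sum>i\<in>I. 1 / (1 + a i)) < of_nat (card I)"
proof -
  have "(\<Sum>i\<in>I. 1 / (1 + a i)) < (\<Sum>i\<in>I. 1)"
    using assms by (intro sum_strict_mono) (auto simp: field_simps add_pos_pos)
  then show ?thesis by simp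
qed

lemma ex_linear_prod_remove_coeff_le:
  fixes a :: "'i \<Rightarrow> 'a::linordered_field"
  assumes "finite I" "I \<noteq> {}" and a: "\<And>i. i \<in> I \<Longrightarrow> 0 < a i"
    and mean: "(\<Sum>i\<in>I. 1 / (1 + a i)) = of_nat (Suc l)"
  shows "\<exists>i\<in>I. coeff (linear_prod a (I - {i})) (Suc l) \<le> coeff (linear_prod a (I - {i})) l"
    and "\<exists>i\<in>I. coeff (linear_prod a (I - {i})) l \<le> coeff (linear_prod a (I - {i})) (Suc l)"
proof -
  define w where "w i = a i / (1 + a i)" for i
  define D where "D i = coeff (linear_prod a (I - {i})) l - coeff (linear_prod a (I - {i})) (Suc l)"
    for i
  have weight_pos: "0 < w i" if "i \<in> I" for i using a[OF that] by (simp add: w_def add_pos_pos)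
  have "1 + a i \<noteq> 0" if "i \<in> I" for i using a[OF that] add_pos_pos[of 1 "a i"] by simp
  then have balance: "(\<Sum>i\<in>I. w i * D i) = 0"
    using sum_weighted_coeff_diff_eq_0[OF assms(1), of a l] mean by (simp add: D_def w_def)
  then have balance_neg: "(\<Sum>i\<in>I. w i * - D i) = 0" by (simp add: sum_negf)
  show "\<exists>i\<in>I. coeff (linear_prod a (I - {i})) (Suc l) \<le> coeff (linear_prod a (I - {i})) l"
    using ex_nonneg_if_weighted_sum_eq_0[of I w D] assms(1,2) weight_pos balance
    by (simp add: D_def)
  show "\<exists>i\<in>I. coeff (linear_prod a (I - {i})) l \<le> coeff (linear_prod a (I - {i})) (Suc l)"
    using ex_nonneg_if_weighted_sum_eq_0[of I w "\<lambda>i. - D i"] assms(1,2) weight_pos balance_neg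
    by (simp add: D_def)
qed

theorem linear_prod_peak_at_mean:
  fixes a :: "'i \<Rightarrow> 'a::linordered_field"
  assumes I: "finite I" "I \<noteq> {}" and a: "\<And>i. i \<in> I \<Longrightarrow> 0 < a i"
    and mean: "(\<Sum>i\<in>I. 1 / (1 + a i)) = of_nat m" and "j \<noteq> m"
  shows "coeff (linear_prod a I) j < coeff (linear_prod a I) m"
proof -
  have "0 < m" using sum_inverse_one_plus_pos[of I a] I a mean by simp
  then obtain l where l: "m = Suc l" using gr0_implies_Suc by blast
  have "m < card I" using sum_inverse_one_plus_less_card[of I a] I a mean by simp
  then have degree: "l < degree (linear_prod a (I - {i}))" if "i \<in> I" for i
    using I(1) that l by (simp add: degree_linear_prod)
  have log_concave: "strict_log_concave (linear_prod a J)" if "J \<subseteq> I" for J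
    using that I(1) a by (intro strict_log_concave_linear_prod) (auto intro: finite_subset)
  note mean_Suc = mean[unfolded l]
  obtain i where i: "i \<in> I"
    "coeff (linear_prod a (I - {i})) (Suc l) \<le> coeff (linear_prod a (I - {i})) l"
    using ex_linear_prod_remove_coeff_le(1)[of I a l] I a mean_Suc by blast
  have right: "coeff (linear_prod a I) (Suc (Suc l)) < coeff (linear_prod a I) (Suc l)"
    unfolding linear_prod_remove[OF I(1) i(1)]
    using log_concave a[OF i(1)] degree[OF i(1)] i(2)
    by (intro linear_mult_coeff_decreasing) auto
  obtain h where h: "h \<in> I"
    "coeff (linear_prod a (I - {h})) l \<le> coeff (linear_prod a (I - {h})) (Suc l)"
    using ex_linear_prod_remove_coeff_le(2)[of I a l] I a mean_Suc by blast
  have left: "coeff (linear_prod a I) l < coeff (linear_prod a I) (Suc l)"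
    unfolding linear_prod_remove[OF I(1) h(1)]
    using log_concave a[OF h(1)] degree[OF h(1)] h(2)
    by (intro linear_mult_coeff_increasing) auto
  show ?thesis
    using strict_log_concave_peak[OF log_concave[OF order_refl] left right] assms(5) l by simp
qed

section \<open>The polynomials \<open>P\<close> and the mean \<open>k0\<close>\<close>

lemma P_Suc: "P s (Suc n) = smult (1 / real (Suc n) powr s) (pCons 0 (\<Sum>k<Suc n. P s k))"
  by (subst P.simps) (simp add: monom_Suc atLeast0LessThan)

lemma P_Suc_Suc:
  "P s (Suc (Suc n)) =
     smult (1 / real (Suc (Suc n)) powr s) ([:real (Suc n) powr s, 1:] * P s (Suc n))"
proof -
  have "pCons 0 (\<Sum>k<Suc n. P s k) = smult (real (Suc n) powr s) (P s (Suc n))"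
    by (simp add: P_Suc[of s n])
  moreover have "pCons 0 (\<Sum>k<Suc (Suc n). P s k) =
      pCons 0 (\<Sum>k<Suc n. P s k) + pCons 0 (P s (Suc n))"
    by simp
  ultimately show ?thesis
    unfolding P_Suc[of s "Suc n"] by (simp only: mult_pCons_left) simp
qed

lemma P_Suc_eq_linear_prod:
  "P s (Suc n) =
     smult (1 / fact (Suc n) powr s) (pCons 0 (linear_prod (\<lambda>k. real k powr s) {1..n}))"
proof (induction n)
  case 0
  show ?case by (simp add: P_Suc P.simps[of s 0] linear_prod_def)
next
  case (Suc n)
  let ?F = "linear_prod (\<lambda>k. real k powr s)"
  have F: "?F {1..Suc n} = [:real (Suc n) powr s, 1:] * ?F {1..n}"
    by (simp add: linear_prod_def mult.commute)
  have "(fact (Suc (Suc n)) :: real) powr s = real (Suc (Suc n)) powr s * fact (Suc n) powr s"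
    by (subst fact_Suc) (rule powr_mult; simp)
  then show ?case
    unfolding P_Suc_Suc Suc.IH F by (simp add: mult_ac del: fact_Suc)
qed

lemma A_Suc:
  "A (Suc n) k s =
     coeff (pCons 0 (linear_prod (\<lambda>i. real i powr s) {1..n})) k / fact (Suc n) powr s"
  by (cases k) (simp_all add: A_def P_Suc_eq_linear_prod del: fact_Suc)

lemma has_peak_atI:
  assumes "k \<le> n" "\<And>j. j \<le> n \<Longrightarrow> j \<noteq> k \<Longrightarrow> a j < a k"
  shows "has_peak_at n a k"
proof -
  have "is_arg_max a (\<lambda>j. j \<le> n) i \<longleftrightarrow> i = k" for i
    unfolding is_arg_max_def using assms by (metis less_asym order_less_irrefl)
  then show ?thesis by (simp add: has_peak_at_def modes_def)
qed

lemma A_peak_at_mean: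
  assumes "1 \<le> n" and mean: "(\<Sum>i=1..n. 1 / (1 + real i powr s)) = real m"
  shows "has_peak_at (Suc n) (\<lambda>j. A (Suc n) j s) (Suc m)"
proof -
  define a :: "nat \<Rightarrow> real" where "a i = real i powr s" for i
  define F where "F = linear_prod a {1..n}"
  have a: "0 < a i" if "i \<in> {1..n}" for i using that by (simp add: a_def)
  have "m < n"
    using sum_inverse_one_plus_less_card[of "{1..n}" a] assms a by (simp add: a_def)
  have peak: "coeff F j < coeff F m" if "j \<noteq> m" for j
    unfolding F_def using assms a that by (intro linear_prod_peak_at_mean) (auto simp: a_def)
  have "0 < coeff F m"
    unfolding F_def using \<open>m < n\<close> a
    by (intro strict_log_concave_coeff_pos strict_log_concave_linear_prod)
      (auto simp: degree_linear_prod)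
  with peak have "coeff (pCons 0 F) j < coeff (pCons 0 F) (Suc m)" if "j \<noteq> Suc m" for j
    using that by (cases j) auto
  then have "A (Suc n) j s < A (Suc n) (Suc m) s" if "j \<noteq> Suc m" for j
    unfolding A_Suc a_def[symmetric] F_def[symmetric]
    using that by (intro divide_strict_right_mono) (auto simp del: fact_Suc)
  then show ?thesis using \<open>m < n\<close> by (intro has_peak_atI) auto
qed

theorem A_peak_at_k0:
  assumes "2 \<le> n" "k0 n s \<in> \<int>"
  shows "\<exists>k. real k = k0 n s \<and> has_peak_at n (\<lambda>j. A n j s) k"
proof -
  obtain N where N: "n = Suc N" "1 \<le> N" using assms(1) by (cases n) auto
  let ?\<mu> = "\<Sum>i=1..N. 1 / (1 + real i powr s)"
  have k0: "k0 n s = 1 + ?\<mu>" by (simp add: k0_def N)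
  have "0 \<le> ?\<mu>" by (intro sum_nonneg) auto
  moreover have "?\<mu> \<in> \<int>" using Ints_diff[OF assms(2) Ints_1] k0 by simp
  ultimately have "?\<mu> \<in> \<nat>" by (simp add: Nats_altdef2)
  then obtain m where m: "?\<mu> = real m" by (rule Nats_cases)
  have "has_peak_at n (\<lambda>j. A n j s) (Suc m)"
    unfolding N(1) using N(2) m by (rule A_peak_at_mean)
  then show ?thesis using k0 m by (intro exI[of _ "Suc m"]) simp
qed

lemma k0_strict_antimono:
  assumes "3 \<le> n" "s < t"
  shows "k0 n t < k0 n s"
proof -
  have "(\<Sum>k=1..n-1. 1 / (1 + real k powr t)) < (\<Sum>k=1..n-1. 1 / (1 + real k powr s))"
  proof (rule sum_strict_mono_ex1)
    show "\<forall>k\<in>{1..n-1}. 1 / (1 + real k powr t) \<le> 1 / (1 + real k powr s)"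
      using assms(2) by (auto intro!: divide_left_mono add_pos_nonneg mult_pos_pos powr_mono)
    show "\<exists>k\<in>{1..n-1}. 1 / (1 + real k powr t) < 1 / (1 + real k powr s)"
      using assms
      by (intro bexI[of _ 2]) (auto intro!: divide_strict_left_mono add_pos_nonneg mult_pos_pos)
  qed simp
  then show ?thesis by (simp add: k0_def)
qed

lemma continuous_on_k0: "continuous_on S (k0 n)"
  unfolding k0_def
  by (intro continuous_intros) (auto simp: add_nonneg_eq_0_iff)

lemma k0_0: "1 \<le> n \<Longrightarrow> k0 n 0 = (real n + 1) / 2"
  by (simp add: k0_def of_nat_diff field_simps)

lemma k0_1:
  assumes "1 \<le> n"
  shows "k0 n 1 = harm n"
proof -
  obtain N where N: "n = Suc N" using assms by (cases n) auto
  have "harm n = (\<Sum>k=0..N. inverse (real (Suc k)))"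
    unfolding harm_def N One_nat_def sum.shift_bounds_cl_Suc_ivl ..
  also have "\<dots> = 1 + (\<Sum>k=1..N. inverse (real (Suc k)))"
    by (simp add: sum.atLeast_Suc_atMost)
  finally show ?thesis by (simp add: k0_def N inverse_eq_divide)
qed

lemma k0_image:
  assumes "3 \<le> n"
  shows "k0 n ` {0<..<1} = {harm n<..<(real n + 1) / 2}"
proof
  have ends: "k0 n 0 = (real n + 1) / 2" "k0 n 1 = harm n" using k0_0 k0_1 assms by auto
  show "k0 n ` {0<..<1} \<subseteq> {harm n<..<(real n + 1) / 2}"
    using k0_strict_antimono[OF assms] by (auto simp flip: ends)
  show "{harm n<..<(real n + 1) / 2} \<subseteq> k0 n ` {0<..<1}"
  proof
    fix x assume x: "x \<in> {harm n<..<(real n + 1) / 2}"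
    then obtain s where s: "0 \<le> s" "s \<le> 1" "k0 n s = x"
      using IVT2'[of "k0 n" 1 x 0] continuous_on_k0 ends by force
    moreover from s x ends have "s \<noteq> 0" "s \<noteq> 1" by auto
    ultimately show "x \<in> k0 n ` {0<..<1}" by force
  qed
qed

theorem theorem4:
  fixes n :: nat
  assumes "n \<ge> 6"
  shows "(\<forall>s::real. 0 < s \<and> s < 1 \<and> k0 n s \<in> \<int> \<longrightarrow>
            (\<exists>k::nat. real k = k0 n s \<and> has_peak_at n (\<lambda>j. A n j s) k))
       \<and> {m::int. \<exists>s::real. 0 < s \<and> s < 1 \<and> k0 n s = real_of_int m}
         = {m::int. harm n < real_of_int m \<and> real_of_int m < (real n + 1) / 2}"
proof (intro conjI allI impI)
  fix s :: real assume "0 < s \<and> s < 1 \<and> k0 n s \<in> \<int>"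
  then show "\<exists>k::nat. real k = k0 n s \<and> has_peak_at n (\<lambda>j. A n j s) k"
    using A_peak_at_k0 assms by simp
next
  have "(\<exists>s. 0 < s \<and> s < 1 \<and> k0 n s = x) \<longleftrightarrow> x \<in> k0 n ` {0<..<1}" for x
    by auto
  then show "{m::int. \<exists>s::real. 0 < s \<and> s < 1 \<and> k0 n s = real_of_int m}
      = {m::int. harm n < real_of_int m \<and> real_of_int m < (real n + 1) / 2}"
    using k0_image assms by simp
qed

end
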